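(* Let $p=p(\rho)$ be a smooth barotropic equation of state with speed of sound $c_s=\sqrt{dp/d\rho}>0$ for $\rho>0$, and let $\bar\rho>0$ be a fixed constant. Let $(\varrho,v^1,v^2,v^3)$ be a classical ($C^3$) solution, on an open subset of the spacetime with Cartesian coordinates $(t,x^1,x^2,x^3)$ (three spatial dimensions), of the compressible Euler equations $$B\varrho=-\operatorname{div}v,\qquad Bv^i=-c_s^2\,\partial_i\varrho\quad(i=1,2,3),$$ where $\varrho=\ln(\rho/\bar\rho)$ is the logarithmic density of a fluid with density $\rho>0$ and $B=\partial_t+v^a\partial_a$. Let $\varpi:=e^{-\varrho}\operatorname{curl}v$ be the specific vorticity, and let $g$ be the acoustical metric determined by $(\varrho,v)$. Then the following equations hold for $i=1,2,3$, where in $\square_g v^i$ the Cartesian component $v^i$ is treated as a scalar-valued function: $$\square_g v^i=-c_s^2e^{\varrho}(\operatorname{curl}\varpi)^i+2e^{\varrho}\epsilon_{iab}(Bv^a)\varpi^b+\mathscr Q^i,$$ $$\square_g\varrho=\mathscr Q,$$ $$B\varpi^i=\varpi^a\partial_av^i,$$ where $$\mathscr Q^i:=-(1+c_s^{-1}c_s')(g^{-1})^{\alpha\beta}\partial_\alpha\varrho\,\partial_\beta v^i,$$ $$\mathscr Q:=-3c_s^{-1}c_s'(g^{-1})^{\alpha\beta}\partial_\alpha\varrho\,\partial_\beta\varrho+2\sum_{1\le a<b\le3}\left\{\partial_av^a\,\partial_bv^b-\partial_av^b\,\partial_bv^a\right\}$$ (no implied summation over $a,b$ inside the braces beyond the displayed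 sum). In addition, $$\operatorname{div}\varpi=-\varpi^a\partial_a\varrho,$$ $$B(\operatorname{curl}\varpi)^i=e^{\varrho}\varpi^a\partial_a\varpi^i-e^{\varrho}\varpi^i\operatorname{div}\varpi+\mathscr P^i_{(\varpi)},$$ where $$\mathscr P^i_{(\varpi)}:=\epsilon_{iab}\left\{(\partial_a\varpi^c)\partial_cv^b-(\partial_av^c)\partial_c\varpi^b\right\}.$$
   Context: Notation and conventions. $x^0=t$; lowercase Greek indices range over $0,1,2,3$ and lowercase Latin indices over $1,2,3$; repeated indices are summed; $\partial_\alpha=\partial/\partial x^\alpha$ are Cartesian partial derivatives. For a vectorfield $X$ and function $f$, $Xf=X^\alpha\partial_\alpha f$. $\epsilon_{ijk}$ is the fully antisymmetric symbol with $\epsilon_{123}=1$. For spatial vectorfields $V=(V^1,V^2,V^3)$, $\operatorname{div}V=\partial_aV^a$ and $(\operatorname{curl}V)^i=\epsilon_{iab}\partial_aV^b$ are the Euclidean divergence and curl. The speed of sound is viewed as a function $c_s=c_s(\varrho)$ of the logarithmic density, and $c_s'=c_s'(\varrho)=\frac{d}{d\varrho}c_s$. The acoustical metric and its inverse are $$g=-dt\otimes dt+c_s^{-2}\sum_{a=1}^3(dx^a-v^adt)\otimes(dx^a-v^adt),\qquad g^{-1}=-B\otimes B+c_s^2\sum_{a=1}^3\partial_a\otimes\partial_a .$$ The covariant wave operator acts on scalar functions $\phi$ by $$\square_g\phi=\frac1{\sqrt{|\det g|}}\,\partial_\alpha\left\{\sqrt{|\det g|}\,(g^{-1})^{\alpha\beta}\partial_\beta\phi\right\}.$$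 *)

theory Defs
  imports "HOL-Analysis.Analysis"
begin

text \<open>Spacetime is \<^typ>\<open>real ^ 4\<close>, whose index type has the elements 0, 1, 2, 3 (with
  component 0 the time coordinate). Spatial vectors are \<^typ>\<open>real ^ 3\<close>, with indices 1, 2, 3.
  In the type \<^typ>\<open>3\<close> we have 3 = 0, so its order is not that of the labels 1, 2, 3 and
  the type coercion to \<^typ>\<open>4\<close> must be spelled out.\<close>

type_synonym spacetime = "real ^ 4"

definition sp :: "3 \<Rightarrow> 4"
  where "sp a = (if a = 1 then 1 else if a = 2 then 2 else 3)"

definition pderiv_coord :: "4 \<Rightarrow> (spacetime \<Rightarrow> real) \<Rightarrow> spacetime \<Rightarrow> real"
  where "pderiv_coord \<alpha> f x = deriv (\<lambda>h. f (x + h *\<^sub>R axis \<alpha> 1)) 0"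

abbreviation pderiv_sp :: "3 \<Rightarrow> (spacetime \<Rightarrow> real) \<Rightarrow> spacetime \<Rightarrow> real"
  where "pderiv_sp a \<equiv> pderiv_coord (sp a)"

text \<open>\<open>C\<^sup>k\<close> regularity, meaningful for open \<open>U\<close>: total differentiability is implied by
  continuity of the partial derivatives, so this is the usual class.\<close>

fun Ck_on :: "nat \<Rightarrow> spacetime set \<Rightarrow> (spacetime \<Rightarrow> real) \<Rightarrow> bool"
  where
    "Ck_on 0 U f = continuous_on U f"
  | "Ck_on (Suc k) U f =
       ((\<forall>x\<in>U. f differentiable (at x)) \<and> (\<forall>\<alpha>. Ck_on k U (pderiv_coord \<alpha> f)))"

definition vf_apply :: "(spacetime \<Rightarrow> real ^ 4) \<Rightarrow> (spacetime \<Rightarrow> real) \<Rightarrow> spacetime \<Rightarrow> real"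
  where "vf_apply X f x = (\<Sum>\<alpha>\<in>UNIV. X x $ \<alpha> * pderiv_coord \<alpha> f x)"

definition levi_civita :: "3 \<Rightarrow> 3 \<Rightarrow> 3 \<Rightarrow> real"
  where "levi_civita i j k =
    (if (i, j, k) \<in> {(1, 2, 3), (2, 3, 1), (3, 1, 2)} then 1
     else if (i, j, k) \<in> {(1, 3, 2), (2, 1, 3), (3, 2, 1)} then -1
     else 0)"

definition divg :: "(spacetime \<Rightarrow> real ^ 3) \<Rightarrow> spacetime \<Rightarrow> real"
  where "divg V x = (\<Sum>a\<in>UNIV. pderiv_sp a (\<lambda>y. V y $ a) x)"

definition curl :: "(spacetime \<Rightarrow> real ^ 3) \<Rightarrow> spacetime \<Rightarrow> real ^ 3"
  where "curl V x =
    (\<chi> i. \<Sum>a\<in>UNIV. \<Sum>b\<in>UNIV. levi_civita i a b * pderiv_sp a (\<lambda>y. V y $ b) x)"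

definition smooth_pos :: "(real \<Rightarrow> real) \<Rightarrow> bool"
  where "smooth_pos p \<longleftrightarrow> (\<forall>n. \<forall>r>0. (deriv ^^ n) p differentiable (at r))"

definition sound_speed :: "(real \<Rightarrow> real) \<Rightarrow> real \<Rightarrow> real"
  where "sound_speed p r = sqrt (deriv p r)"

text \<open>The speed of sound as a function of the logarithmic density \<open>s = ln (r / rbar)\<close>.\<close>

definition sound_speed_log :: "(real \<Rightarrow> real) \<Rightarrow> real \<Rightarrow> real \<Rightarrow> real"
  where "sound_speed_log p rbar s = sound_speed p (rbar * exp s)"

definition material :: "(spacetime \<Rightarrow> real ^ 3) \<Rightarrow> spacetime \<Rightarrow> real ^ 4"
  where "material v x = axis 0 1 + (\<Sum>a\<in>UNIV. (v x $ a) *\<^sub>R axis (sp a) 1)"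

text \<open>In the remaining definitions \<open>c\<close> is the speed of sound as a function of the logarithmic
  density \<open>lrho\<close>. The coordinate covectors \<open>dx\<^sup>\<alpha>\<close> and the coordinate vectors
  \<open>\<partial>\<^sub>\<alpha>\<close> both have the components \<^term>\<open>axis \<alpha> 1\<close>.\<close>

definition euler ::
  "(real \<Rightarrow> real) \<Rightarrow> (spacetime \<Rightarrow> real) \<Rightarrow> (spacetime \<Rightarrow> real ^ 3) \<Rightarrow> spacetime set \<Rightarrow> bool"
  where "euler c lrho v U \<longleftrightarrow>
    (\<forall>x\<in>U. vf_apply (material v) lrho x = - divg v x \<and>
      (\<forall>i. vf_apply (material v) (\<lambda>y. v y $ i) x = - (c (lrho x))\<^sup>2 * pderiv_sp i lrho x))"

definition specific_vorticity ::
  "(spacetime \<Rightarrow> real) \<Rightarrow> (spacetime \<Rightarrow> real ^ 3) \<Rightarrow> spacetime \<Rightarrow> real ^ 3"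
  where "specific_vorticity lrho v x = exp (- lrho x) *\<^sub>R curl v x"

definition dx_minus_v_dt :: "(spacetime \<Rightarrow> real ^ 3) \<Rightarrow> 3 \<Rightarrow> spacetime \<Rightarrow> real ^ 4"
  where "dx_minus_v_dt v a x = axis (sp a) 1 - (v x $ a) *\<^sub>R axis 0 1"

definition acoustic_metric ::
  "(real \<Rightarrow> real) \<Rightarrow> (spacetime \<Rightarrow> real) \<Rightarrow> (spacetime \<Rightarrow> real ^ 3) \<Rightarrow> spacetime \<Rightarrow> real ^ 4 ^ 4"
  where "acoustic_metric c lrho v x =
    (\<chi> \<alpha> \<beta>. - ((axis 0 1 :: real ^ 4) $ \<alpha> * (axis 0 1 :: real ^ 4) $ \<beta>)
       + inverse ((c (lrho x))\<^sup>2) *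
         (\<Sum>a\<in>UNIV. dx_minus_v_dt v a x $ \<alpha> * dx_minus_v_dt v a x $ \<beta>))"

definition acoustic_inv ::
  "(real \<Rightarrow> real) \<Rightarrow> (spacetime \<Rightarrow> real) \<Rightarrow> (spacetime \<Rightarrow> real ^ 3) \<Rightarrow> spacetime \<Rightarrow> real ^ 4 ^ 4"
  where "acoustic_inv c lrho v x =
    (\<chi> \<alpha> \<beta>. - (material v x $ \<alpha> * material v x $ \<beta>)
       + (c (lrho x))\<^sup>2 *
         (\<Sum>a\<in>UNIV. (axis (sp a) 1 :: real ^ 4) $ \<alpha> * (axis (sp a) 1 :: real ^ 4) $ \<beta>))"

lemma acoustic_metric_inverse:
  assumes "c (lrho x) \<noteq> 0"
  shows "acoustic_metric c lrho v x ** acoustic_inv c lrho v x = mat 1"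
    and "acoustic_inv c lrho v x ** acoustic_metric c lrho v x = mat 1"
proof -
  show *: "acoustic_metric c lrho v x ** acoustic_inv c lrho v x = mat 1"
    using assms
    by (simp add: vec_eq_iff forall_4 matrix_matrix_mult_def mat_def acoustic_metric_def
        acoustic_inv_def material_def dx_minus_v_dt_def sum_4 sum_3 sp_def axis_def field_simps)
  show "acoustic_inv c lrho v x ** acoustic_metric c lrho v x = mat 1"
    using * matrix_left_right_inverse by blast
qed

definition contract ::
  "(spacetime \<Rightarrow> real ^ 4 ^ 4) \<Rightarrow> (spacetime \<Rightarrow> real) \<Rightarrow> (spacetime \<Rightarrow> real) \<Rightarrow> spacetime \<Rightarrow> real"
  where "contract h \<phi> \<psi> x =
    (\<Sum>\<alpha>\<in>UNIV. \<Sum>\<beta>\<in>UNIV. h x $ \<alpha> $ \<beta> * pderiv_coord \<alpha> \<phi> x * pderiv_coord \<beta> \<psi> x)"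

text \<open>The inverse metric is passed separately, as \<open>h\<close>; for the acoustic metric see
  \<open>acoustic_metric_inverse\<close>.\<close>

definition wave_op ::
  "(spacetime \<Rightarrow> real ^ 4 ^ 4) \<Rightarrow> (spacetime \<Rightarrow> real ^ 4 ^ 4) \<Rightarrow> (spacetime \<Rightarrow> real) \<Rightarrow> spacetime \<Rightarrow> real"
  where "wave_op g h \<phi> x =
    1 / sqrt \<bar>det (g x)\<bar> *
    (\<Sum>\<alpha>\<in>UNIV. pderiv_coord \<alpha>
       (\<lambda>y. sqrt \<bar>det (g y)\<bar> * (\<Sum>\<beta>\<in>UNIV. h y $ \<alpha> $ \<beta> * pderiv_coord \<beta> \<phi> y)) x)"

definition acoustic_wave ::
  "(real \<Rightarrow> real) \<Rightarrow> (spacetime \<Rightarrow> real) \<Rightarrow> (spacetime \<Rightarrow> real ^ 3) \<Rightarrow>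
     (spacetime \<Rightarrow> real) \<Rightarrow> spacetime \<Rightarrow> real"
  where "acoustic_wave c lrho v = wave_op (acoustic_metric c lrho v) (acoustic_inv c lrho v)"

definition Q_vel ::
  "(real \<Rightarrow> real) \<Rightarrow> (spacetime \<Rightarrow> real) \<Rightarrow> (spacetime \<Rightarrow> real ^ 3) \<Rightarrow> 3 \<Rightarrow> spacetime \<Rightarrow> real"
  where "Q_vel c lrho v i x =
    - (1 + inverse (c (lrho x)) * deriv c (lrho x))
      * contract (acoustic_inv c lrho v) lrho (\<lambda>y. v y $ i) x"

text \<open>The pairs \<open>a < b\<close> are listed because of the order of the type \<^typ>\<open>3\<close>.\<close>

definition Q_dens ::
  "(real \<Rightarrow> real) \<Rightarrow> (spacetime \<Rightarrow> real) \<Rightarrow> (spacetime \<Rightarrow> real ^ 3) \<Rightarrow> spacetime \<Rightarrow> real"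
  where "Q_dens c lrho v x =
    - 3 * inverse (c (lrho x)) * deriv c (lrho x) * contract (acoustic_inv c lrho v) lrho lrho x
    + 2 * (\<Sum>(a, b)\<in>{(1, 2), (1, 3), (2, 3)}.
        pderiv_sp a (\<lambda>y. v y $ a) x * pderiv_sp b (\<lambda>y. v y $ b) x
        - pderiv_sp a (\<lambda>y. v y $ b) x * pderiv_sp b (\<lambda>y. v y $ a) x)"

definition P_vort ::
  "(spacetime \<Rightarrow> real ^ 3) \<Rightarrow> (spacetime \<Rightarrow> real ^ 3) \<Rightarrow> 3 \<Rightarrow> spacetime \<Rightarrow> real"
  where "P_vort v w i x =
    (\<Sum>a\<in>UNIV. \<Sum>b\<in>UNIV. levi_civita i a b *
      ((\<Sum>c\<in>UNIV. pderiv_sp a (\<lambda>y. w y $ c) x * pderiv_sp c (\<lambda>y. v y $ b) x)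
       - (\<Sum>c\<in>UNIV. pderiv_sp a (\<lambda>y. v y $ c) x * pderiv_sp c (\<lambda>y. w y $ b) x)))"

end

theory Submission
  imports Defs
begin

text \<open>All five equations are consequences of the Euler system differentiated once or twice, and
  they rest on three mechanisms. Here \<open>\<varrho>\<close> denotes the logarithmic density.

  The first is the wave operator in terms of the flow. In the coframe \<open>dt, dx\<^sup>a - v\<^sup>a dt\<close> the
  acoustical metric is diagonal, so \<open>\<surd>\<bar>det g\<bar> = c\<^sup>-\<^sup>3\<close>, and the divergence form
  of the wave operator becomes \<open>- B B f + c\<^sup>2 \<Delta>f\<close> plus terms that are products of first
  derivatives (\<open>acoustic_wave_eq\<close>). The wave equations then reduce to computing \<open>B B \<varrho>\<close> and
  \<open>B B v\<^sup>i\<close>.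

  The second is the commutator \<open>[\<partial>\<^sub>\<alpha>, B] = (\<partial>\<^sub>\<alpha> v\<^sup>a) \<partial>\<^sub>a\<close> (\<open>pderiv_coord_material\<close>), which
  rests on the symmetry of second derivatives (\<open>pderiv_coord_commute\<close>). Applying \<open>B\<close> to one
  Euler equation and commuting it through the spatial derivative on the right makes the other Euler
  equation applicable. For the density this closes: \<open>B B \<varrho>\<close> is \<open>c\<^sup>2 \<Delta>\<varrho>\<close> plus quadratic terms. For
  the velocity it produces \<open>c\<^sup>2 \<nabla> div v\<close> in place of \<open>c\<^sup>2 \<Delta>v\<close>; the difference is
  \<open>c\<^sup>2 curl curl v\<close>, a first derivative of the vorticity (\<open>exp_curl_vorticity\<close>).

  The third is that the acceleration \<open>- c\<^sup>2 \<nabla>\<varrho>\<close> of a barotropic fluid is a gradient. Its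
  derivative is symmetric (\<open>material_grad_vel\<close>), so the curl of the momentum equation contains no
  pressure, and the factor \<open>e\<^sup>-\<^sup>\<varrho>\<close> in the specific vorticity absorbs the dilatation. The equation
  for \<open>curl \<omega>\<close> follows by taking one more curl; because \<open>curl v = e\<^sup>\<varrho> \<omega>\<close>, the second derivatives
  of \<open>v\<close> in it are first derivatives of \<open>\<omega>\<close> and \<open>\<varrho>\<close>.

  Once derivatives are moved into a common order, what remains in each case is a polynomial
  identity in the values of finitely many derivatives at one point.\<close>

section \<open>Partial derivatives\<close>

lemma pderiv_coord_has_derivative:
  assumes "f differentiable (at x)"
  shows "((\<lambda>h. f (x + h *\<^sub>R axis \<alpha> 1)) has_real_derivative pderiv_coord \<alpha> f x) (at 0)"
proof -
  have "(f \<circ> (\<lambda>h. x + h *\<^sub>R axis \<alpha> 1)) differentiable (at 0)"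
    by (rule differentiable_chain_at) (use assms in \<open>auto intro!: derivative_intros\<close>)
  then show ?thesis
    by (simp add: pderiv_coord_def DERIV_deriv_iff_real_differentiable o_def)
qed

lemma pderiv_coord_cong:
  assumes "open U" "x \<in> U" "\<And>y. y \<in> U \<Longrightarrow> f y = g y"
  shows "pderiv_coord \<alpha> f x = pderiv_coord \<alpha> g x"
proof -
  have "((\<lambda>h. x + h *\<^sub>R axis \<alpha> 1) \<longlongrightarrow> x + 0 *\<^sub>R axis \<alpha> (1::real)) (nhds 0)"
    by (intro tendsto_intros filterlim_ident)
  then have "\<forall>\<^sub>F h in nhds 0. x + h *\<^sub>R axis \<alpha> 1 \<in> U"
    using assms(1,2) by (auto intro: topological_tendstoD)
  then have "\<forall>\<^sub>F h in nhds 0. f (x + h *\<^sub>R axis \<alpha> 1) = g (x + h *\<^sub>R axis \<alpha> 1)"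
    by eventually_elim (rule assms(3))
  then show ?thesis
    unfolding pderiv_coord_def by (rule deriv_cong_ev) simp
qed

lemma pderiv_coord_const [simp]: "pderiv_coord \<alpha> (\<lambda>y. k) x = 0"
  by (simp add: pderiv_coord_def)

lemma pderiv_coord_add:
  assumes "f differentiable (at x)" "g differentiable (at x)"
  shows "pderiv_coord \<alpha> (\<lambda>y. f y + g y) x = pderiv_coord \<alpha> f x + pderiv_coord \<alpha> g x"
  using DERIV_add [OF pderiv_coord_has_derivative pderiv_coord_has_derivative, OF assms]
  unfolding pderiv_coord_def [of _ "\<lambda>y. f y + g y"] by (rule DERIV_imp_deriv)

lemma pderiv_coord_mult:
  assumes "f differentiable (at x)" "g differentiable (at x)"
  shows "pderiv_coord \<alpha> (\<lambda>y. f y * g y) x = pderiv_coord \<alpha> f x * g x + f x * pderiv_coord \<alpha> g x"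
  using DERIV_mult [OF pderiv_coord_has_derivative pderiv_coord_has_derivative, OF assms, of \<alpha> \<alpha>]
  unfolding pderiv_coord_def [of _ "\<lambda>y. f y * g y"]
  by (auto dest: DERIV_imp_deriv simp: algebra_simps)

lemma pderiv_coord_minus:
  assumes "f differentiable (at x)"
  shows "pderiv_coord \<alpha> (\<lambda>y. - f y) x = - pderiv_coord \<alpha> f x"
  using DERIV_minus [OF pderiv_coord_has_derivative, OF assms]
  unfolding pderiv_coord_def [of _ "\<lambda>y. - f y"] by (rule DERIV_imp_deriv)

lemma pderiv_coord_sum:
  assumes "finite I" "\<And>i. i \<in> I \<Longrightarrow> f i differentiable (at x)"
  shows "pderiv_coord \<alpha> (\<lambda>y. \<Sum>i\<in>I. f i y) x = (\<Sum>i\<in>I. pderiv_coord \<alpha> (f i) x)"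
  using assms by (induction rule: finite_induct) (simp_all add: pderiv_coord_add)

lemma pderiv_coord_compose:
  assumes "(F has_real_derivative F') (at (f x))" "f differentiable (at x)"
  shows "pderiv_coord \<alpha> (\<lambda>y. F (f y)) x = F' * pderiv_coord \<alpha> f x"
  using DERIV_chain2 [OF _ pderiv_coord_has_derivative, OF _ assms(2), of F F'] assms(1)
  unfolding pderiv_coord_def [of _ "\<lambda>y. F (f y)"] by (auto dest: DERIV_imp_deriv)

lemma differentiable_real_compose:
  fixes f :: "spacetime \<Rightarrow> real"
  assumes "(F has_real_derivative F') (at (f x))" "f differentiable (at x)"
  shows "(\<lambda>y. F (f y)) differentiable (at x)"
  using differentiable_chain_at [of f x F] assms
  by (auto simp: o_def real_differentiable_def differentiable_def has_field_derivative_def)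

section \<open>Functions of class \<open>C\<^sup>k\<close>\<close>

lemma Ck_on_pderiv: "Ck_on (Suc k) U f \<Longrightarrow> Ck_on k U (pderiv_coord \<alpha> f)"
  by simp

lemma C2_differentiable: "Ck_on 2 U f \<Longrightarrow> x \<in> U \<Longrightarrow> f differentiable (at x)"
  by (simp add: numeral_2_eq_2)

lemma C2_pderiv_differentiable:
  "Ck_on 2 U f \<Longrightarrow> x \<in> U \<Longrightarrow> pderiv_coord \<alpha> f differentiable (at x)"
  by (simp add: numeral_2_eq_2)

lemma Ck_on_Suc_imp: "Ck_on (Suc k) U f \<Longrightarrow> Ck_on k U f"
proof (induction k arbitrary: f)
  case 0
  then show ?case
    by (auto intro!: continuous_at_imp_continuous_on differentiable_imp_continuous_within)
next
  case (Suc k)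
  then show ?case
    by (metis Ck_on.simps(2))
qed

lemma Ck_on_mono: "Ck_on k U f \<Longrightarrow> j \<le> k \<Longrightarrow> Ck_on j U f"
  by (induction k) (auto simp: le_Suc_eq intro: Ck_on_Suc_imp simp del: Ck_on.simps)

lemma differentiable_cong_open:
  fixes f :: "spacetime \<Rightarrow> real"
  assumes "f differentiable (at x)" "open U" "x \<in> U" "\<And>y. y \<in> U \<Longrightarrow> f y = g y"
  shows "g differentiable (at x)"
  using assms has_derivative_transform_within_open [of f _ x UNIV U g]
  unfolding differentiable_def by blast

lemma Ck_on_cong:
  assumes "open U" "\<And>y. y \<in> U \<Longrightarrow> f y = g y" "Ck_on k U f"
  shows "Ck_on k U g"
  using assms(2,3)
proof (induction k arbitrary: f g)
  case 0
  then show ?case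
    by (auto cong: continuous_on_cong)
next
  case (Suc k)
  have "Ck_on k U (pderiv_coord \<alpha> g)" for \<alpha>
    by (rule Suc.IH [of "pderiv_coord \<alpha> f"])
      (use Suc.prems assms(1) pderiv_coord_cong [of U _ f g] in auto)
  then show ?case
    using Suc.prems differentiable_cong_open [of f _ U g] assms(1) by auto
qed

lemma Ck_on_const: "Ck_on k U (\<lambda>y. r)"
proof (induction k arbitrary: r)
  case (Suc k)
  have "pderiv_coord \<alpha> (\<lambda>y. r) = (\<lambda>y. 0)" for \<alpha>
    by (rule ext) simp
  with Suc show ?case
    by simp
qed simp

lemma Ck_on_add:
  assumes "open U" "Ck_on k U f" "Ck_on k U g"
  shows "Ck_on k U (\<lambda>y. f y + g y)"
  using assms(2,3)
proof (induction k arbitrary: f g)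
  case 0
  then show ?case
    by (auto intro: continuous_intros)
next
  case (Suc k)
  have "Ck_on k U (pderiv_coord \<alpha> (\<lambda>y. f y + g y))" for \<alpha>
    by (rule Ck_on_cong [OF assms(1) _ Suc.IH [of "pderiv_coord \<alpha> f" "pderiv_coord \<alpha> g"]])
      (use Suc.prems in \<open>auto simp: pderiv_coord_add\<close>)
  then show ?case
    using Suc.prems by auto
qed

lemma Ck_on_sum:
  assumes "open U" "finite I" "\<And>i. i \<in> I \<Longrightarrow> Ck_on k U (f i)"
  shows "Ck_on k U (\<lambda>y. \<Sum>i\<in>I. f i y)"
  using assms(2,3)
  by (induction rule: finite_induct) (simp_all add: Ck_on_const Ck_on_add [OF assms(1)])

lemma Ck_on_mult:
  assumes "open U" "Ck_on k U f" "Ck_on k U g"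
  shows "Ck_on k U (\<lambda>y. f y * g y)"
  using assms(2,3)
proof (induction k arbitrary: f g)
  case 0
  then show ?case
    by (auto intro: continuous_intros)
next
  case (Suc k)
  have "Ck_on k U (pderiv_coord \<alpha> (\<lambda>y. f y * g y))" for \<alpha>
  proof (rule Ck_on_cong [OF assms(1)])
    show "Ck_on k U (\<lambda>y. pderiv_coord \<alpha> f y * g y + f y * pderiv_coord \<alpha> g y)"
      using Suc.prems Ck_on_Suc_imp [OF Suc.prems(1)] Ck_on_Suc_imp [OF Suc.prems(2)]
      by (intro Ck_on_add [OF assms(1)] Suc.IH) auto
  qed (use Suc.prems in \<open>auto simp: pderiv_coord_mult\<close>)
  then show ?case
    using Suc.prems by auto
qed

lemma Ck_on_exp:
  assumes "open U" "Ck_on k U f"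
  shows "Ck_on k U (\<lambda>y. exp (f y))"
  using assms(2)
proof (induction k arbitrary: f)
  case 0
  then show ?case
    by (auto intro: continuous_intros)
next
  case (Suc k)
  have "Ck_on k U (pderiv_coord \<alpha> (\<lambda>y. exp (f y)))" for \<alpha>
  proof (rule Ck_on_cong [OF assms(1)])
    show "Ck_on k U (\<lambda>y. exp (f y) * pderiv_coord \<alpha> f y)"
      using Suc.prems Ck_on_Suc_imp [OF Suc.prems]
      by (intro Ck_on_mult [OF assms(1)] Suc.IH) auto
  qed (use Suc.prems in \<open>auto simp: pderiv_coord_compose [OF DERIV_exp]\<close>)
  then show ?case
    using Suc.prems differentiable_real_compose [OF DERIV_exp, of f] by auto
qed

section \<open>Symmetry of second partial derivatives\<close>

lemma pderiv_coord_has_derivative_line: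
  assumes "f differentiable (at (x + s *\<^sub>R axis \<alpha> 1))"
  shows "((\<lambda>h. f (x + h *\<^sub>R axis \<alpha> 1)) has_real_derivative
      pderiv_coord \<alpha> f (x + s *\<^sub>R axis \<alpha> 1)) (at s)"
  using pderiv_coord_has_derivative [OF assms, of \<alpha>]
    DERIV_shift [of "\<lambda>h. f (x + h *\<^sub>R axis \<alpha> 1)" _ 0 s]
  by (simp add: algebra_simps)

text \<open>The second difference of \<open>f\<close> over the rectangle with sides \<open>h e\<^sub>\<alpha>\<close> and \<open>h e\<^sub>\<beta>\<close> is an
  increment along \<open>e\<^sub>\<alpha>\<close> of an increment along \<open>e\<^sub>\<beta>\<close>, so two applications of the mean value
  theorem express it by one mixed derivative. Its value does not depend on which of the two
  directions is treated first; that is the source of the symmetry of mixed derivatives.\<close>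

lemma second_difference_mean_value:
  assumes f: "Ck_on 2 U f" and h: "h > 0"
    and sub: "\<And>s t. 0 \<le> s \<Longrightarrow> s \<le> h \<Longrightarrow> 0 \<le> t \<Longrightarrow> t \<le> h \<Longrightarrow>
      x + s *\<^sub>R axis \<alpha> 1 + t *\<^sub>R axis \<beta> 1 \<in> U"
  obtains s t where "0 < s" "s < h" "0 < t" "t < h"
    "f (x + h *\<^sub>R axis \<alpha> 1 + h *\<^sub>R axis \<beta> 1) - f (x + h *\<^sub>R axis \<alpha> 1)
      - f (x + h *\<^sub>R axis \<beta> 1) + f x
     = h\<^sup>2 * pderiv_coord \<beta> (pderiv_coord \<alpha> f) (x + s *\<^sub>R axis \<alpha> 1 + t *\<^sub>R axis \<beta> 1)"
proof -
  let ?a = "axis \<alpha> 1 :: spacetime" and ?b = "axis \<beta> 1 :: spacetime"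
  have diff: "f differentiable (at y)" "pderiv_coord \<alpha> f differentiable (at y)" if "y \<in> U" for y
    using f that by (auto simp: numeral_2_eq_2)
  have sub0: "x + s *\<^sub>R ?a \<in> U" if "0 \<le> s" "s \<le> h" for s
    using sub [OF that, of 0] h by simp
  have "\<exists>s. 0 < s \<and> s < h \<and>
      (f (x + h *\<^sub>R ?b + h *\<^sub>R ?a) - f (x + h *\<^sub>R ?a)) - (f (x + h *\<^sub>R ?b + 0 *\<^sub>R ?a) - f (x + 0 *\<^sub>R ?a))
      = (h - 0) * (pderiv_coord \<alpha> f (x + h *\<^sub>R ?b + s *\<^sub>R ?a) - pderiv_coord \<alpha> f (x + s *\<^sub>R ?a))"
  proof (rule MVT2 [OF h])
    fix s assume s: "0 \<le> s" "s \<le> h"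
    show "((\<lambda>s. f (x + h *\<^sub>R ?b + s *\<^sub>R ?a) - f (x + s *\<^sub>R ?a)) has_real_derivative
        pderiv_coord \<alpha> f (x + h *\<^sub>R ?b + s *\<^sub>R ?a) - pderiv_coord \<alpha> f (x + s *\<^sub>R ?a)) (at s)"
      using sub [OF s, of h] sub0 [OF s] h
      by (intro DERIV_diff pderiv_coord_has_derivative_line diff) (simp_all add: algebra_simps)
  qed
  then obtain s where s: "0 < s" "s < h"
    and eq1: "f (x + h *\<^sub>R ?b + h *\<^sub>R ?a) - f (x + h *\<^sub>R ?a) - (f (x + h *\<^sub>R ?b) - f x)
      = h * (pderiv_coord \<alpha> f (x + s *\<^sub>R ?a + h *\<^sub>R ?b) - pderiv_coord \<alpha> f (x + s *\<^sub>R ?a))"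
    by (auto simp: algebra_simps)
  have "\<exists>t. 0 < t \<and> t < h \<and>
      pderiv_coord \<alpha> f (x + s *\<^sub>R ?a + h *\<^sub>R ?b) - pderiv_coord \<alpha> f (x + s *\<^sub>R ?a + 0 *\<^sub>R ?b)
      = (h - 0) * pderiv_coord \<beta> (pderiv_coord \<alpha> f) (x + s *\<^sub>R ?a + t *\<^sub>R ?b)"
    by (rule MVT2 [OF h]) (use s sub in \<open>auto intro!: pderiv_coord_has_derivative_line diff\<close>)
  then obtain t where t: "0 < t" "t < h"
    and eq2: "pderiv_coord \<alpha> f (x + s *\<^sub>R ?a + h *\<^sub>R ?b) - pderiv_coord \<alpha> f (x + s *\<^sub>R ?a)
      = h * pderiv_coord \<beta> (pderiv_coord \<alpha> f) (x + s *\<^sub>R ?a + t *\<^sub>R ?b)"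
    by auto
  show ?thesis
    by (rule that [OF s t]) (use eq1 eq2 in \<open>simp add: algebra_simps power2_eq_square\<close>)
qed

text \<open>Read in both orders, the second difference shows that the two mixed derivatives agree at some
  pair of points arbitrarily close to \<open>x\<close>. By continuity they cannot differ at \<open>x\<close>.\<close>

lemma pderiv_coord_commute:
  assumes f: "Ck_on 2 U f" and U: "open U" "x \<in> U"
  shows "pderiv_coord \<alpha> (pderiv_coord \<beta> f) x = pderiv_coord \<beta> (pderiv_coord \<alpha> f) x"
proof (rule ccontr)
  let ?P = "pderiv_coord \<alpha> (pderiv_coord \<beta> f)" and ?Q = "pderiv_coord \<beta> (pderiv_coord \<alpha> f)"
  assume "?P x \<noteq> ?Q x"
  then have e: "\<bar>?P x - ?Q x\<bar> / 2 > 0" (is "?e > 0")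
    by simp
  have "isCont ?P x" "isCont ?Q x"
    using f U by (auto simp: numeral_2_eq_2 continuous_on_eq_continuous_at)
  then obtain d1 d2 where d: "d1 > 0" "d2 > 0"
    and P: "\<And>y. dist y x < d1 \<Longrightarrow> \<bar>?P y - ?P x\<bar> < ?e"
    and Q: "\<And>y. dist y x < d2 \<Longrightarrow> \<bar>?Q y - ?Q x\<bar> < ?e"
    using e unfolding continuous_at_eps_delta dist_real_def by metis
  from U obtain r where r: "r > 0" "ball x r \<subseteq> U"
    by (auto simp: open_contains_ball)
  define h where "h = min r (min d1 d2) / 3"
  have h: "h > 0" "2 * h < r" "2 * h < d1" "2 * h < d2"
    using d r by (auto simp: h_def min_def)
  have near: "dist (x + s *\<^sub>R axis \<alpha> 1 + t *\<^sub>R axis \<beta> 1) x \<le> 2 * h"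
      "dist (x + t *\<^sub>R axis \<beta> 1 + s *\<^sub>R axis \<alpha> 1) x \<le> 2 * h"
    if "0 \<le> s" "s \<le> h" "0 \<le> t" "t \<le> h" for s t :: real and \<alpha> \<beta> :: 4
    using that norm_triangle_ineq [of "s *\<^sub>R axis \<alpha> (1::real)" "t *\<^sub>R axis \<beta> 1"]
    by (auto simp: dist_norm add.commute add.left_commute)
  have sub: "x + s *\<^sub>R axis \<alpha> 1 + t *\<^sub>R axis \<beta> 1 \<in> U"
    if "0 \<le> s" "s \<le> h" "0 \<le> t" "t \<le> h" for s t :: real and \<alpha> \<beta> :: 4
    using near(1) [OF that, of \<alpha> \<beta>] h r(2) by (force simp: dist_commute)
  obtain s t where st: "0 < s" "s < h" "0 < t" "t < h"
    and eqQ: "f (x + h *\<^sub>R axis \<alpha> 1 + h *\<^sub>R axis \<beta> 1) - f (x + h *\<^sub>R axis \<alpha> 1)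
      - f (x + h *\<^sub>R axis \<beta> 1) + f x = h\<^sup>2 * ?Q (x + s *\<^sub>R axis \<alpha> 1 + t *\<^sub>R axis \<beta> 1)"
    by (rule second_difference_mean_value [OF f h(1), of x \<alpha> \<beta>]) (use sub in blast)+
  obtain s' t' where st': "0 < s'" "s' < h" "0 < t'" "t' < h"
    and eqP: "f (x + h *\<^sub>R axis \<beta> 1 + h *\<^sub>R axis \<alpha> 1) - f (x + h *\<^sub>R axis \<beta> 1)
      - f (x + h *\<^sub>R axis \<alpha> 1) + f x = h\<^sup>2 * ?P (x + s' *\<^sub>R axis \<beta> 1 + t' *\<^sub>R axis \<alpha> 1)"
    by (rule second_difference_mean_value [OF f h(1), of x \<beta> \<alpha>]) (use sub in blast)+
  have "h\<^sup>2 * ?P (x + s' *\<^sub>R axis \<beta> 1 + t' *\<^sub>R axis \<alpha> 1)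
      = h\<^sup>2 * ?Q (x + s *\<^sub>R axis \<alpha> 1 + t *\<^sub>R axis \<beta> 1)"
    unfolding eqP [symmetric] eqQ [symmetric] by (simp add: algebra_simps)
  then have "?P (x + s' *\<^sub>R axis \<beta> 1 + t' *\<^sub>R axis \<alpha> 1)
      = ?Q (x + s *\<^sub>R axis \<alpha> 1 + t *\<^sub>R axis \<beta> 1)"
    using h by simp
  moreover have "\<bar>?P (x + s' *\<^sub>R axis \<beta> 1 + t' *\<^sub>R axis \<alpha> 1) - ?P x\<bar> < ?e"
    by (rule P) (use near(1) [of s' t' \<beta> \<alpha>] st' h in linarith)
  moreover have "\<bar>?Q (x + s *\<^sub>R axis \<alpha> 1 + t *\<^sub>R axis \<beta> 1) - ?Q x\<bar> < ?e"
    by (rule Q) (use near(1) [of s t \<alpha> \<beta>] st h in linarith)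
  ultimately show False
    by argo
qed

section \<open>Spatial components\<close>

text \<open>The index \<open>0\<close> is the same element of \<^typ>\<open>4\<close> as \<open>4\<close>. This splitting into the time index and the
  three spatial indices is the form in which all spacetime contractions are used.\<close>

lemma sum_spacetime: "(\<Sum>\<alpha>\<in>UNIV. f \<alpha>) = f 0 + (\<Sum>a\<in>UNIV. f (sp a))" for f :: "4 \<Rightarrow> real"
proof -
  have "f 4 = f 0"
    by (rule arg_cong [of _ _ f]) simp
  then show ?thesis
    by (simp add: sum_4 sum_3 sp_def)
qed

lemma sp_neq_0 [simp]: "sp a \<noteq> 0" "0 \<noteq> sp a"
  by (simp_all add: sp_def)

lemma sp_eq_iff [simp]: "sp a = sp b \<longleftrightarrow> a = b"
  using exhaust_3 [of a] exhaust_3 [of b] by (auto simp: sp_def)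

lemma material_nth [simp]: "material v x $ 0 = 1" "material v x $ sp a = v x $ a"
  by (simp_all add: material_def axis_def if_distrib cong: if_cong)

lemma det_4: "det (A :: 'a::comm_ring_1 ^ 4 ^ 4) =
   A$1$1 * (A$2$2 * A$3$3 * A$4$4 + A$2$3 * A$3$4 * A$4$2 + A$2$4 * A$3$2 * A$4$3
     - A$2$2 * A$3$4 * A$4$3 - A$2$3 * A$3$2 * A$4$4 - A$2$4 * A$3$3 * A$4$2)
   - A$1$2 * (A$2$1 * A$3$3 * A$4$4 + A$2$3 * A$3$4 * A$4$1 + A$2$4 * A$3$1 * A$4$3
     - A$2$1 * A$3$4 * A$4$3 - A$2$3 * A$3$1 * A$4$4 - A$2$4 * A$3$3 * A$4$1)
   + A$1$3 * (A$2$1 * A$3$2 * A$4$4 + A$2$2 * A$3$4 * A$4$1 + A$2$4 * A$3$1 * A$4$2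
     - A$2$1 * A$3$4 * A$4$2 - A$2$2 * A$3$1 * A$4$4 - A$2$4 * A$3$2 * A$4$1)
   - A$1$4 * (A$2$1 * A$3$2 * A$4$3 + A$2$2 * A$3$3 * A$4$1 + A$2$3 * A$3$1 * A$4$2
     - A$2$1 * A$3$3 * A$4$2 - A$2$2 * A$3$1 * A$4$3 - A$2$3 * A$3$2 * A$4$1)"
proof -
  have f: "finite {2::4, 3, 4}" "1 \<notin> {2::4, 3, 4}" "finite {3::4, 4}" "2 \<notin> {3::4, 4}"
    "finite {4::4}" "3 \<notin> {4::4}"
    by auto
  show ?thesis
    unfolding det_def UNIV_4
    unfolding sum_over_permutations_insert[OF f(1,2)]
    unfolding sum_over_permutations_insert[OF f(3,4)]
    unfolding sum_over_permutations_insert[OF f(5,6)]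
    unfolding permutes_sing
    by (simp add: sign_swap_id sign_compose permutation_swap_id permutation_compose sign_id swap_id_eq algebra_simps)
qed

text \<open>In the coframe \<open>dt, dx\<^sup>a - v\<^sup>a dt\<close>, which is unimodular over the coordinate coframe, the
  metric is diagonal with entries \<open>-1, c\<^sup>-\<^sup>2, c\<^sup>-\<^sup>2, c\<^sup>-\<^sup>2\<close>. Hence the density
  \<open>\<surd>\<bar>det g\<bar>\<close> of the wave operator is \<open>c\<^sup>-\<^sup>3\<close> and does not see the velocity.\<close>

lemma det_acoustic_metric:
  assumes "c (lrho x) \<noteq> 0"
  shows "det (acoustic_metric c lrho v x) = - inverse ((c (lrho x)) ^ 6)"
  using assms
  by (simp add: det_4 acoustic_metric_def dx_minus_v_dt_def sum_3 sp_def axis_def field_simps power_eq_if)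

section \<open>Vectorfields acting on functions\<close>

lemma vf_apply_cong:
  assumes "open U" "x \<in> U" "\<And>y. y \<in> U \<Longrightarrow> f y = g y"
  shows "vf_apply X f x = vf_apply X g x"
  unfolding vf_apply_def using pderiv_coord_cong [OF assms] by simp

lemma vf_apply_mult:
  assumes "f differentiable (at x)" "g differentiable (at x)"
  shows "vf_apply X (\<lambda>y. f y * g y) x = vf_apply X f x * g x + f x * vf_apply X g x"
  unfolding vf_apply_def pderiv_coord_mult [OF assms]
  by (simp add: sum.distrib sum_distrib_left sum_distrib_right algebra_simps)

lemma vf_apply_minus:
  assumes "f differentiable (at x)"
  shows "vf_apply X (\<lambda>y. - f y) x = - vf_apply X f x"
  unfolding vf_apply_def pderiv_coord_minus [OF assms] by (simp add: sum_negf)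

lemma vf_apply_add:
  assumes "f differentiable (at x)" "g differentiable (at x)"
  shows "vf_apply X (\<lambda>y. f y + g y) x = vf_apply X f x + vf_apply X g x"
  unfolding vf_apply_def pderiv_coord_add [OF assms] by (simp add: sum.distrib algebra_simps)

lemma vf_apply_sum:
  assumes "finite I" "\<And>i. i \<in> I \<Longrightarrow> f i differentiable (at x)"
  shows "vf_apply X (\<lambda>y. \<Sum>i\<in>I. f i y) x = (\<Sum>i\<in>I. vf_apply X (f i) x)"
  using assms
  by (induction rule: finite_induct) (simp_all add: vf_apply_add, simp add: vf_apply_def)

lemma vf_apply_compose:
  assumes "(F has_real_derivative F') (at (f x))" "f differentiable (at x)"
  shows "vf_apply X (\<lambda>y. F (f y)) x = F' * vf_apply X f x"
  unfolding vf_apply_def pderiv_coord_compose [OF assms] by (simp add: sum_distrib_left algebra_simps)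

lemma vf_apply_material:
  "vf_apply (material v) f x = pderiv_coord 0 f x + (\<Sum>a\<in>UNIV. v x $ a * pderiv_sp a f x)"
  by (simp add: vf_apply_def sum_spacetime)

lemma differentiable_vf_apply_material:
  assumes "Ck_on 2 U f" "x \<in> U" "\<And>a. (\<lambda>y. v y $ a) differentiable (at x)"
  shows "vf_apply (material v) f differentiable (at x)"
proof -
  have "pderiv_coord \<alpha> f differentiable (at x)" for \<alpha>
    using assms by (simp add: numeral_2_eq_2)
  with assms(3) have "(\<lambda>x. pderiv_coord 0 f x + (\<Sum>a\<in>UNIV. v x $ a * pderiv_sp a f x)) differentiable (at x)"
    by auto
  then show ?thesis
    unfolding vf_apply_material [abs_def] .
qed

text \<open>The commutator \<open>[\<partial>\<^sub>\<alpha>, B] = (\<partial>\<^sub>\<alpha> v\<^sup>a) \<partial>\<^sub>a\<close>: second derivatives of \<open>f\<close> cancel by symmetry, and only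
  derivatives of the coefficients of \<open>B\<close> remain. Every evolution equation below is the
  Euler system differentiated through this identity.\<close>

lemma pderiv_coord_material:
  assumes "open U" "x \<in> U" "Ck_on 2 U f" "\<And>a. (\<lambda>y. v y $ a) differentiable (at x)"
  shows "pderiv_coord \<alpha> (vf_apply (material v) f) x = vf_apply (material v) (pderiv_coord \<alpha> f) x
     + (\<Sum>a\<in>UNIV. pderiv_coord \<alpha> (\<lambda>y. v y $ a) x * pderiv_sp a f x)"
proof -
  have [simp]: "pderiv_coord \<beta> f differentiable (at x)" for \<beta>
    using assms by (simp add: numeral_2_eq_2)
  have "pderiv_coord \<alpha> (vf_apply (material v) f) x
      = pderiv_coord \<alpha> (pderiv_coord 0 f) x
        + (\<Sum>a\<in>UNIV. pderiv_coord \<alpha> (\<lambda>y. v y $ a) x * pderiv_sp a f x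
             + v x $ a * pderiv_coord \<alpha> (pderiv_sp a f) x)"
    unfolding vf_apply_material [abs_def]
    by (simp add: pderiv_coord_add pderiv_coord_sum pderiv_coord_mult assms(4))
  then show ?thesis
    by (simp add: vf_apply_material sum.distrib pderiv_coord_commute [OF assms(3,1,2), of \<alpha>])
qed

section \<open>The acoustical wave operator\<close>

lemma acoustic_inv_nth:
  "acoustic_inv c lrho v x $ 0 $ 0 = - 1"
  "acoustic_inv c lrho v x $ 0 $ sp b = - (v x $ b)"
  "acoustic_inv c lrho v x $ sp a $ 0 = - (v x $ a)"
  "acoustic_inv c lrho v x $ sp a $ sp b
     = - (v x $ a * v x $ b) + (if a = b then (c (lrho x))\<^sup>2 else 0)"
  by (auto simp: acoustic_inv_def axis_def if_distrib [of "\<lambda>z. z * _"] if_distrib [of "\<lambda>z. _ * z"]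
      cong: if_cong)

text \<open>Raising the index of \<open>df\<close> gives the vectorfield \<open>-(B f) B + c\<^sup>2 \<nabla>f\<close>.\<close>

lemma acoustic_inv_raise:
  "(\<Sum>\<beta>\<in>UNIV. acoustic_inv c lrho v x $ 0 $ \<beta> * pderiv_coord \<beta> f x)
     = - vf_apply (material v) f x"
  "(\<Sum>\<beta>\<in>UNIV. acoustic_inv c lrho v x $ sp a $ \<beta> * pderiv_coord \<beta> f x)
     = - (v x $ a * vf_apply (material v) f x) + (c (lrho x))\<^sup>2 * pderiv_sp a f x"
  by (simp_all add: sum_spacetime vf_apply_material acoustic_inv_nth distrib_left distrib_right
      left_diff_distrib sum.distrib sum_subtractf sum_distrib_left sum_negf if_distrib [of "\<lambda>z. z * _"] mult.assoc cong: if_cong)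

lemma contract_acoustic_inv:
  "contract (acoustic_inv c lrho v) f g x =
     - (vf_apply (material v) f x * vf_apply (material v) g x)
     + (c (lrho x))\<^sup>2 * (\<Sum>a\<in>UNIV. pderiv_sp a f x * pderiv_sp a g x)"
proof -
  let ?r = "\<lambda>\<alpha>. \<Sum>\<beta>\<in>UNIV. acoustic_inv c lrho v x $ \<alpha> $ \<beta> * pderiv_coord \<beta> g x"
  have "contract (acoustic_inv c lrho v) f g x = (\<Sum>\<alpha>\<in>UNIV. pderiv_coord \<alpha> f x * ?r \<alpha>)"
    by (simp add: contract_def sum_distrib_left mult.left_commute mult.assoc)
  also have "\<dots> = pderiv_coord 0 f x * ?r 0 + (\<Sum>a\<in>UNIV. pderiv_sp a f x * ?r (sp a))"
    by (rule sum_spacetime)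
  also have "\<dots> = - (vf_apply (material v) f x * vf_apply (material v) g x)
     + (c (lrho x))\<^sup>2 * (\<Sum>a\<in>UNIV. pderiv_sp a f x * pderiv_sp a g x)"
    unfolding acoustic_inv_raise vf_apply_material [of v f] sum_3 by algebra
  finally show ?thesis .
qed

text \<open>The wave operator is \<open>c\<^sup>3\<close> times the divergence of \<open>- c\<^sup>-\<^sup>3 (B f) B + c\<^sup>-\<^sup>1 \<nabla>f\<close>.
  The divergence of \<open>W B\<close> is \<open>B W + W div v\<close>, here with \<open>W = c\<^sup>-\<^sup>3 B f\<close>, and all derivatives of
  the density come from differentiating \<open>c\<^sup>-\<^sup>3\<close> and \<open>c\<^sup>-\<^sup>1\<close>.\<close>

lemma acoustic_wave_eq:
  assumes U: "open U" "x \<in> U" and f: "Ck_on 2 U f"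
    and c_pos: "\<And>y. y \<in> U \<Longrightarrow> c (lrho y) > 0"
    and c_deriv: "(c has_real_derivative c') (at (lrho x))"
    and lrho: "lrho differentiable (at x)"
    and v: "\<And>a y. y \<in> U \<Longrightarrow> (\<lambda>y. v y $ a) differentiable (at y)"
  shows "acoustic_wave c lrho v f x =
    - vf_apply (material v) (vf_apply (material v) f) x
    - divg v x * vf_apply (material v) f x
    + 3 * inverse (c (lrho x)) * c' * vf_apply (material v) lrho x * vf_apply (material v) f x
    + (c (lrho x))\<^sup>2 * (\<Sum>a\<in>UNIV. pderiv_sp a (pderiv_sp a f) x)
    - c (lrho x) * c' * (\<Sum>a\<in>UNIV. pderiv_sp a lrho x * pderiv_sp a f x)"
    (is "_ = ?rhs")
proof -
  let ?B = "vf_apply (material v)" and ?h = "acoustic_inv c lrho v"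
  let ?\<kappa> = "\<lambda>y. inverse (c (lrho y) ^ 3)" and ?\<mu> = "\<lambda>y. inverse (c (lrho y))"
  let ?W = "\<lambda>y. ?\<kappa> y * ?B f y"
  let ?F = "\<lambda>\<alpha> y. sqrt \<bar>det (acoustic_metric c lrho v y)\<bar> *
      (\<Sum>\<beta>\<in>UNIV. ?h y $ \<alpha> $ \<beta> * pderiv_coord \<beta> f y)"
  have c0: "c (lrho x) > 0"
    using c_pos U by simp
  have root: "sqrt \<bar>det (acoustic_metric c lrho v y)\<bar> = ?\<kappa> y" if "y \<in> U" for y
  proof -
    have "\<bar>det (acoustic_metric c lrho v y)\<bar> = (?\<kappa> y)\<^sup>2"
      using c_pos [OF that] by (simp add: det_acoustic_metric power_inverse flip: power_mult)
    then show ?thesis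
      using c_pos [OF that] by (simp add: less_imp_le)
  qed
  have \<kappa>': "((\<lambda>s. inverse (c s ^ 3)) has_real_derivative - 3 * c' * inverse (c (lrho x) ^ 4)) (at (lrho x))"
    using c0 by (auto intro!: derivative_eq_intros c_deriv simp: field_simps power_eq_if)
  have \<mu>': "((\<lambda>s. inverse (c s)) has_real_derivative - c' * inverse ((c (lrho x))\<^sup>2)) (at (lrho x))"
    using c0 by (auto intro!: derivative_eq_intros c_deriv simp: field_simps power_eq_if)
  have Bf: "?B f differentiable (at x)"
    by (rule differentiable_vf_apply_material [OF f U(2) v [OF U(2)]])
  have df: "pderiv_coord \<alpha> f differentiable (at x)" for \<alpha>
    using f U by (simp add: numeral_2_eq_2)
  have \<kappa>: "?\<kappa> differentiable (at x)" and \<mu>: "?\<mu> differentiable (at x)"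
    using differentiable_real_compose [OF \<kappa>' lrho] differentiable_real_compose [OF \<mu>' lrho] by auto
  have W: "?W differentiable (at x)"
    using \<kappa> Bf by simp
  have F0: "pderiv_coord 0 (?F 0) x = - pderiv_coord 0 ?W x"
  proof -
    have "pderiv_coord 0 (?F 0) x = pderiv_coord 0 (\<lambda>y. - ?W y) x"
      by (rule pderiv_coord_cong [OF U]) (simp add: root acoustic_inv_raise)
    then show ?thesis
      by (simp add: pderiv_coord_minus W)
  qed
  have Fa: "pderiv_sp a (?F (sp a)) x
      = - (pderiv_sp a (\<lambda>y. v y $ a) x * ?W x + v x $ a * pderiv_sp a ?W x)
        + (- c' * inverse ((c (lrho x))\<^sup>2) * pderiv_sp a lrho x * pderiv_sp a f x
           + ?\<mu> x * pderiv_sp a (pderiv_sp a f) x)" for a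
  proof -
    have "pderiv_sp a (?F (sp a)) x
        = pderiv_sp a (\<lambda>y. - (v y $ a * ?W y) + ?\<mu> y * pderiv_sp a f y) x"
    proof (rule pderiv_coord_cong [OF U])
      fix y assume "y \<in> U"
      then show "?F (sp a) y = - (v y $ a * ?W y) + ?\<mu> y * pderiv_sp a f y"
        unfolding acoustic_inv_raise using c_pos [of y]
        by (simp add: root field_simps power_eq_if)
    qed
    also have "\<dots> = pderiv_sp a (\<lambda>y. - (v y $ a * ?W y)) x + pderiv_sp a (\<lambda>y. ?\<mu> y * pderiv_sp a f y) x"
      by (rule pderiv_coord_add) (intro differentiable_minus differentiable_mult v U W \<mu> df)+
    also have "pderiv_sp a (\<lambda>y. - (v y $ a * ?W y)) x
        = - (pderiv_sp a (\<lambda>y. v y $ a) x * ?W x + v x $ a * pderiv_sp a ?W x)"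
      by (subst pderiv_coord_minus, intro differentiable_mult v U W)
        (subst pderiv_coord_mult, intro v U, rule W, rule refl)
    also have "pderiv_sp a (\<lambda>y. ?\<mu> y * pderiv_sp a f y) x
        = - c' * inverse ((c (lrho x))\<^sup>2) * pderiv_sp a lrho x * pderiv_sp a f x
           + ?\<mu> x * pderiv_sp a (pderiv_sp a f) x"
      by (subst pderiv_coord_mult [OF \<mu> df], subst pderiv_coord_compose [OF \<mu>' lrho]) (rule refl)
    finally show ?thesis .
  qed
  have BW: "?B ?W x = - 3 * c' * inverse (c (lrho x) ^ 4) * ?B lrho x * ?B f x + ?\<kappa> x * ?B (?B f) x"
    by (subst vf_apply_mult [OF \<kappa> Bf], subst vf_apply_compose [OF \<kappa>' lrho]) (rule refl)
  have "acoustic_wave c lrho v f x = c (lrho x) ^ 3 *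
      (pderiv_coord 0 (?F 0) x + (\<Sum>a\<in>UNIV. pderiv_sp a (?F (sp a)) x))"
    unfolding acoustic_wave_def wave_op_def sum_spacetime [of "\<lambda>\<alpha>. pderiv_coord \<alpha> (?F \<alpha>) x"]
    using root [OF U(2)] by (simp add: inverse_eq_divide)
  also have "pderiv_coord 0 (?F 0) x + (\<Sum>a\<in>UNIV. pderiv_sp a (?F (sp a)) x)
      = - ?B ?W x - divg v x * ?W x
        - c' * inverse ((c (lrho x))\<^sup>2) * (\<Sum>a\<in>UNIV. pderiv_sp a lrho x * pderiv_sp a f x)
        + ?\<mu> x * (\<Sum>a\<in>UNIV. pderiv_sp a (pderiv_sp a f) x)"
    unfolding F0 Fa vf_apply_material [of v ?W] divg_def sum_3 by algebra
  also have "c (lrho x) ^ 3 * \<dots> = ?rhs"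
    unfolding BW using c0 by (simp add: field_simps power_eq_if)
  finally show ?thesis .
qed

section \<open>Components of curls\<close>

lemma sum_levi_civita:
  "(\<Sum>a\<in>UNIV. \<Sum>b\<in>UNIV. levi_civita 1 a b * f a b) = f 2 3 - f 3 2"
  "(\<Sum>a\<in>UNIV. \<Sum>b\<in>UNIV. levi_civita 2 a b * f a b) = f 3 1 - f 1 3"
  "(\<Sum>a\<in>UNIV. \<Sum>b\<in>UNIV. levi_civita 3 a b * f a b) = f 1 2 - f 2 1"
  by (simp_all add: sum_3 levi_civita_def)

lemma curl_nth:
  "curl V x $ 1 = pderiv_sp 2 (\<lambda>y. V y $ 3) x - pderiv_sp 3 (\<lambda>y. V y $ 2) x"
  "curl V x $ 2 = pderiv_sp 3 (\<lambda>y. V y $ 1) x - pderiv_sp 1 (\<lambda>y. V y $ 3) x"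
  "curl V x $ 3 = pderiv_sp 1 (\<lambda>y. V y $ 2) x - pderiv_sp 2 (\<lambda>y. V y $ 1) x"
  by (simp_all add: curl_def sum_levi_civita)

lemma pderiv_coord_curl:
  assumes "\<And>a b. pderiv_sp a (\<lambda>y. V y $ b) differentiable (at x)"
  shows "pderiv_coord \<alpha> (\<lambda>y. curl V y $ i) x =
    (\<Sum>a\<in>UNIV. \<Sum>b\<in>UNIV. levi_civita i a b * pderiv_coord \<alpha> (pderiv_sp a (\<lambda>y. V y $ b)) x)"
  unfolding curl_def vec_lambda_beta
  using assms by (simp add: pderiv_coord_sum pderiv_coord_mult)

lemma vf_apply_curl:
  assumes "\<And>a b. pderiv_sp a (\<lambda>y. V y $ b) differentiable (at x)"
  shows "vf_apply X (\<lambda>y. curl V y $ i) x =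
    (\<Sum>a\<in>UNIV. \<Sum>b\<in>UNIV. levi_civita i a b * vf_apply X (pderiv_sp a (\<lambda>y. V y $ b)) x)"
  unfolding curl_def vec_lambda_beta
  using assms by (simp add: vf_apply_sum vf_apply_mult) (simp add: vf_apply_def)

section \<open>Barotropic flows\<close>

text \<open>The equation of state enters only through the speed of sound \<open>c\<close>, as a positive
  differentiable function of the logarithmic density.\<close>

locale euler_flow =
  fixes c :: "real \<Rightarrow> real" and lrho :: "spacetime \<Rightarrow> real" and v :: "spacetime \<Rightarrow> real ^ 3"
    and U :: "spacetime set"
  assumes open_U: "open U"
    and C3_dens: "Ck_on 3 U lrho"
    and C3_vel: "Ck_on 3 U (\<lambda>x. v x $ i)"
    and speed_pos: "c s > 0"
    and speed_deriv: "(c has_real_derivative deriv c s) (at s)"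
    and euler: "euler c lrho v U"
begin

abbreviation B :: "(spacetime \<Rightarrow> real) \<Rightarrow> spacetime \<Rightarrow> real"
  where "B \<equiv> vf_apply (material v)"

abbreviation vort :: "spacetime \<Rightarrow> real ^ 3" ("\<omega>")
  where "\<omega> \<equiv> specific_vorticity lrho v"

abbreviation vel :: "3 \<Rightarrow> spacetime \<Rightarrow> real"
  where "vel i \<equiv> \<lambda>y. v y $ i"

lemma Ck_dens: "Ck_on 2 U lrho" and Ck_vel: "Ck_on 2 U (vel i)"
  and Ck_vel_pderiv: "Ck_on 2 U (pderiv_coord \<alpha> (vel i))"
  using C3_dens C3_vel [of i] Ck_on_mono [of 3 U _ 2] Ck_on_pderiv [of 2 U]
  by (auto simp: numeral_3_eq_3 numeral_2_eq_2 simp del: Ck_on.simps)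

lemma Ck_vort: "Ck_on 2 U (\<lambda>y. \<omega> y $ i)"
proof -
  have exp: "Ck_on 2 U (\<lambda>y. exp (- lrho y))"
    using Ck_on_exp [OF open_U Ck_on_mult [OF open_U Ck_on_const Ck_dens, of "- 1"]] by simp
  have "Ck_on 2 U (\<lambda>y. curl v y $ i)"
    unfolding curl_def vec_lambda_beta
    by (intro Ck_on_sum Ck_on_mult open_U Ck_on_const Ck_vel_pderiv finite)
  from Ck_on_mult [OF open_U exp this] show ?thesis
    by (simp add: specific_vorticity_def)
qed

lemmas dens_differentiable = C2_differentiable [OF Ck_dens]
lemmas vel_differentiable = C2_differentiable [OF Ck_vel]

lemma pderiv_commute:
  "Ck_on 2 U f \<Longrightarrow> x \<in> U \<Longrightarrow>
    pderiv_coord \<alpha> (pderiv_coord \<beta> f) x = pderiv_coord \<beta> (pderiv_coord \<alpha> f) x"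
  by (rule pderiv_coord_commute [OF _ open_U])

lemma material_pderiv:
  assumes "x \<in> U" "Ck_on 2 U f"
  shows "B (pderiv_coord \<alpha> f) x =
     pderiv_coord \<alpha> (B f) x - (\<Sum>a\<in>UNIV. pderiv_coord \<alpha> (vel a) x * pderiv_sp a f x)"
  using pderiv_coord_material [OF open_U assms vel_differentiable [OF assms(1)], of \<alpha>] by simp

lemma material_dens: "x \<in> U \<Longrightarrow> B lrho x = - divg v x"
  and material_vel: "x \<in> U \<Longrightarrow> B (vel i) x = - ((c (lrho x))\<^sup>2 * pderiv_sp i lrho x)"
  using euler by (auto simp: euler_def)

lemma speed_square_deriv:
  "((\<lambda>s. (c s)\<^sup>2) has_real_derivative 2 * c s * deriv c s) (at s)"
  by (auto intro!: derivative_eq_intros speed_deriv)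

lemma speed_square_differentiable:
  "x \<in> U \<Longrightarrow> (\<lambda>y. (c (lrho y))\<^sup>2) differentiable (at x)"
  by (rule differentiable_real_compose [OF speed_square_deriv dens_differentiable])

text \<open>The acceleration is \<open>- c\<^sup>2 \<nabla>\<varrho>\<close> with \<open>c\<close> a function of \<open>\<varrho>\<close>, hence a gradient. The first bracket,
  minus the derivative of the acceleration, is therefore symmetric in \<open>a\<close> and \<open>i\<close>: it disappears from the evolution of the
  curl, whereas its trace supplies the Laplacian in the wave equation for the density.\<close>

lemma material_grad_vel:
  assumes x: "x \<in> U"
  shows "B (pderiv_sp a (vel i)) x =
    - (2 * c (lrho x) * deriv c (lrho x) * pderiv_sp a lrho x * pderiv_sp i lrho x
       + (c (lrho x))\<^sup>2 * pderiv_sp a (pderiv_sp i lrho) x)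
    - (\<Sum>b\<in>UNIV. pderiv_sp a (vel b) x * pderiv_sp b (vel i) x)"
proof -
  have d: "pderiv_sp i lrho differentiable (at x)"
    by (rule C2_pderiv_differentiable [OF Ck_dens x])
  have "pderiv_sp a (B (vel i)) x = pderiv_sp a (\<lambda>y. - ((c (lrho y))\<^sup>2 * pderiv_sp i lrho y)) x"
    by (rule pderiv_coord_cong [OF open_U x material_vel])
  also have "\<dots> = - (2 * c (lrho x) * deriv c (lrho x) * pderiv_sp a lrho x * pderiv_sp i lrho x
       + (c (lrho x))\<^sup>2 * pderiv_sp a (pderiv_sp i lrho) x)"
    by (subst pderiv_coord_minus, intro differentiable_mult speed_square_differentiable x d)
      (simp add: pderiv_coord_mult [OF speed_square_differentiable [OF x] d]
        pderiv_coord_compose [OF speed_square_deriv dens_differentiable [OF x]])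
  finally show ?thesis
    by (simp add: material_pderiv [OF x Ck_vel])
qed

text \<open>By the continuity equation the divergence of \<open>v\<close> in the wave operator becomes \<open>- B \<varrho>\<close>, so that all
  the lower order terms are quadratic in first derivatives.\<close>

lemma wave_eq:
  assumes "x \<in> U" "Ck_on 2 U f"
  shows "acoustic_wave c lrho v f x =
    - B (B f) x + B lrho x * B f x
    + 3 * inverse (c (lrho x)) * deriv c (lrho x) * B lrho x * B f x
    + (c (lrho x))\<^sup>2 * (\<Sum>a\<in>UNIV. pderiv_sp a (pderiv_sp a f) x)
    - c (lrho x) * deriv c (lrho x) * (\<Sum>a\<in>UNIV. pderiv_sp a lrho x * pderiv_sp a f x)"
  using acoustic_wave_eq [OF open_U assms speed_pos speed_deriv dens_differentiable [OF assms(1)]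
      vel_differentiable] material_dens [OF assms(1)]
  by simp

lemma material_material_dens:
  assumes x: "x \<in> U"
  shows "B (B lrho) x = - (\<Sum>a\<in>UNIV. B (pderiv_sp a (vel a)) x)"
proof -
  have d: "pderiv_sp a (vel a) differentiable (at x)" for a
    by (rule C2_pderiv_differentiable [OF Ck_vel x])
  have "B (B lrho) x = B (\<lambda>y. - (\<Sum>a\<in>UNIV. pderiv_sp a (vel a) y)) x"
    by (rule vf_apply_cong [OF open_U x]) (simp add: material_dens divg_def)
  then show ?thesis
    using d by (simp add: vf_apply_minus vf_apply_sum)
qed

text \<open>The momentum equation differentiated along the flow: \<open>B \<partial>\<^sub>i \<varrho>\<close> is computed by commuting \<open>B\<close> with
  \<open>\<partial>\<^sub>i\<close> and using the continuity equation, and \<open>c\<^sup>2 \<partial>\<^sub>i \<varrho>\<close> is replaced by \<open>- B v\<^sup>i\<close> in the term that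
  contains \<open>c'\<close>, which turns it into a part of the contraction of \<open>d\<varrho>\<close> and \<open>dv\<^sup>i\<close> with the inverse metric.\<close>

lemma material_material_vel:
  assumes x: "x \<in> U"
  shows "B (B (vel i)) x = 2 * inverse (c (lrho x)) * deriv c (lrho x) * B lrho x * B (vel i) x
    + (c (lrho x))\<^sup>2 * (\<Sum>a\<in>UNIV. pderiv_sp i (pderiv_sp a (vel a)) x
        + pderiv_sp i (vel a) x * pderiv_sp a lrho x)"
proof -
  have d: "pderiv_sp i lrho differentiable (at x)"
    by (rule C2_pderiv_differentiable [OF Ck_dens x])
  have dv: "pderiv_sp a (vel a) differentiable (at x)" for a
    by (rule C2_pderiv_differentiable [OF Ck_vel x])
  have "B (B (vel i)) x = B (\<lambda>y. - ((c (lrho y))\<^sup>2 * pderiv_sp i lrho y)) x"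
    by (rule vf_apply_cong [OF open_U x material_vel])
  also have "\<dots> = - (2 * c (lrho x) * deriv c (lrho x) * B lrho x * pderiv_sp i lrho x
       + (c (lrho x))\<^sup>2 * B (pderiv_sp i lrho) x)"
    by (subst vf_apply_minus, intro differentiable_mult speed_square_differentiable x d)
      (simp add: vf_apply_mult [OF speed_square_differentiable [OF x] d]
        vf_apply_compose [OF speed_square_deriv dens_differentiable [OF x]])
  also have "B (pderiv_sp i lrho) x = - (\<Sum>a\<in>UNIV. pderiv_sp i (pderiv_sp a (vel a)) x
        + pderiv_sp i (vel a) x * pderiv_sp a lrho x)"
  proof -
    have "pderiv_sp i (B lrho) x = pderiv_sp i (\<lambda>y. - (\<Sum>a\<in>UNIV. pderiv_sp a (vel a) y)) x"
      by (rule pderiv_coord_cong [OF open_U x]) (simp add: material_dens divg_def)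
    then show ?thesis
      using dv by (simp add: material_pderiv [OF x Ck_dens] pderiv_coord_minus pderiv_coord_sum
          sum.distrib)
  qed
  finally show ?thesis
    using speed_pos [of "lrho x"] by (simp add: material_vel [OF x] field_simps power2_eq_square)
qed

lemma curl_vel: "curl v x $ i = exp (lrho x) * \<omega> x $ i"
  by (simp add: specific_vorticity_def exp_minus)

lemma pderiv_curl_vel:
  assumes x: "x \<in> U"
  shows "pderiv_coord \<alpha> (\<lambda>y. curl v y $ i) x
    = exp (lrho x) * (pderiv_coord \<alpha> lrho x * \<omega> x $ i + pderiv_coord \<alpha> (\<lambda>y. \<omega> y $ i) x)"
  unfolding curl_vel
  by (subst pderiv_coord_mult)
    (auto simp: pderiv_coord_compose [OF DERIV_exp] dens_differentiable x algebra_simps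
      intro!: differentiable_real_compose [OF DERIV_exp] C2_differentiable [OF Ck_vort])

text \<open>The divergence of \<open>curl v = e\<^sup>\<varrho> \<omega>\<close> vanishes.\<close>

theorem div_vorticity:
  assumes x: "x \<in> U"
  shows "divg \<omega> x = - (\<Sum>a\<in>UNIV. \<omega> x $ a * pderiv_sp a lrho x)"
proof -
  have "exp (lrho x) * (\<Sum>a\<in>UNIV. pderiv_sp a lrho x * \<omega> x $ a + pderiv_sp a (\<lambda>y. \<omega> y $ a) x)
      = (\<Sum>a\<in>UNIV. pderiv_sp a (\<lambda>y. curl v y $ a) x)"
    by (simp add: pderiv_curl_vel [OF x] sum_distrib_left)
  also have "\<dots> = pderiv_sp 1 (\<lambda>y. curl v y $ 1) x + pderiv_sp 2 (\<lambda>y. curl v y $ 2) x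
      + pderiv_sp 3 (\<lambda>y. curl v y $ 3) x"
    by (rule sum_3)
  also have "\<dots> = 0"
    unfolding pderiv_coord_curl [OF C2_pderiv_differentiable [OF Ck_vel x]] sum_levi_civita
      pderiv_commute [OF Ck_vel x, of "sp 2" "sp 1"] pderiv_commute [OF Ck_vel x, of "sp 3" "sp 1"]
      pderiv_commute [OF Ck_vel x, of "sp 3" "sp 2"]
    by algebra
  finally have "(\<Sum>a\<in>UNIV. pderiv_sp a lrho x * \<omega> x $ a + pderiv_sp a (\<lambda>y. \<omega> y $ a) x) = 0"
    by simp
  then show ?thesis
    by (simp add: divg_def sum.distrib mult.commute)
qed

text \<open>The curl of the Euler equations. The pressure contributes a symmetric matrix, and the
  remaining \<open>\<epsilon>\<^sub>i\<^sub>a\<^sub>b \<partial>\<^sub>a v\<^sup>c \<partial>\<^sub>c v\<^sup>b\<close> is, by a polynomial identity in the nine entries of \<open>\<nabla>v\<close>, the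
  stretching term and the dilatation term of the vorticity equation.\<close>

lemma material_curl_vel:
  assumes x: "x \<in> U"
  shows "B (\<lambda>y. curl v y $ i) x
    = (\<Sum>a\<in>UNIV. curl v x $ a * pderiv_sp a (vel i) x) - divg v x * curl v x $ i"
proof -
  have "\<forall>i. B (\<lambda>y. curl v y $ i) x
    = (\<Sum>a\<in>UNIV. curl v x $ a * pderiv_sp a (vel i) x) - divg v x * curl v x $ i"
    unfolding vf_apply_curl [OF C2_pderiv_differentiable [OF Ck_vel x]] material_grad_vel [OF x]
      forall_3 sum_levi_civita
    unfolding sum_3 curl_nth divg_def
      pderiv_commute [OF Ck_dens x, of "sp 2" "sp 1"] pderiv_commute [OF Ck_dens x, of "sp 3" "sp 1"]
      pderiv_commute [OF Ck_dens x, of "sp 3" "sp 2"]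
    by algebra
  then show ?thesis ..
qed

text \<open>The weight \<open>e\<^sup>-\<^sup>\<varrho>\<close> is chosen so that the continuity equation cancels the dilatation term.\<close>

theorem material_vorticity:
  assumes x: "x \<in> U"
  shows "B (\<lambda>y. \<omega> y $ i) x = (\<Sum>a\<in>UNIV. \<omega> x $ a * pderiv_sp a (vel i) x)"
proof -
  have "B (\<lambda>y. curl v y $ i) x = exp (lrho x) * (B lrho x * \<omega> x $ i + B (\<lambda>y. \<omega> y $ i) x)"
    by (simp only: vf_apply_def pderiv_curl_vel [OF x])
      (simp add: sum.distrib sum_distrib_left sum_distrib_right algebra_simps)
  also have "B (\<lambda>y. curl v y $ i) x = exp (lrho x) *
      ((\<Sum>a\<in>UNIV. \<omega> x $ a * pderiv_sp a (vel i) x) + B lrho x * \<omega> x $ i)"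
    unfolding material_curl_vel [OF x] unfolding curl_vel material_dens [OF x] sum_3 by algebra
  finally show ?thesis
    by simp
qed

text \<open>By \<open>material_material_dens\<close> and \<open>material_grad_vel\<close>, \<open>B B \<varrho>\<close> equals \<open>c\<^sup>2 \<Delta>\<varrho>\<close> up to
  products of first derivatives, and the Laplacians cancel. What is left of the velocity is
  \<open>(div v)\<^sup>2 - \<partial>\<^sub>a v\<^sup>b \<partial>\<^sub>b v\<^sup>a\<close>, twice the second elementary symmetric function of \<open>\<nabla>v\<close>.\<close>

theorem wave_dens:
  assumes x: "x \<in> U"
  shows "acoustic_wave c lrho v lrho x = Q_dens c lrho v x"
proof -
  have "(\<Sum>(a, b)\<in>{(1, 2), (1, 3), (2, 3)}. F a b) = F 1 2 + F 1 3 + F 2 3"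
    for F :: "3 \<Rightarrow> 3 \<Rightarrow> real"
    by simp
  note pairs = this
  \<comment> \<open>Moving one factor of \<open>c\<close> makes \<open>c\<^sup>-\<^sup>1 c'\<close> a common factor of all terms that contain \<open>c'\<close>; after
    that the two sides agree as polynomials.\<close>
  have cq: "c (lrho x) * deriv c (lrho x) = (c (lrho x))\<^sup>2 * (inverse (c (lrho x)) * deriv c (lrho x))"
    using speed_pos [of "lrho x"] by (simp add: power2_eq_square)
  show ?thesis
    unfolding wave_eq [OF x Ck_dens] material_material_dens [OF x] material_grad_vel [OF x]
      Q_dens_def contract_acoustic_inv pairs material_dens [OF x] divg_def sum_3
    using cq by algebra
qed

text \<open>The identity \<open>curl curl v = \<nabla> div v - \<Delta>v\<close> for \<open>curl v = e\<^sup>\<varrho> \<omega>\<close>, with the term \<open>\<nabla>\<varrho> \<times> curl v\<close>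
  that arises from the factor \<open>e\<^sup>\<varrho>\<close> written in the derivatives of \<open>v\<close>.\<close>

lemma exp_curl_vorticity:
  assumes x: "x \<in> U"
  shows "exp (lrho x) * curl \<omega> x $ i =
    (\<Sum>a\<in>UNIV. pderiv_sp i (pderiv_sp a (vel a)) x - pderiv_sp a (pderiv_sp a (vel i)) x)
    - (\<Sum>a\<in>UNIV. pderiv_sp a lrho x * (pderiv_sp i (vel a) x - pderiv_sp a (vel i) x))"
proof -
  have *: "exp (lrho x) * pderiv_sp a (\<lambda>y. \<omega> y $ b) x
      = pderiv_sp a (\<lambda>y. curl v y $ b) x - pderiv_sp a lrho x * curl v x $ b" for a b
    by (simp add: pderiv_curl_vel [OF x]) (simp add: curl_vel algebra_simps)
  have "\<forall>i. exp (lrho x) * curl \<omega> x $ i =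
    (\<Sum>a\<in>UNIV. pderiv_sp i (pderiv_sp a (vel a)) x - pderiv_sp a (pderiv_sp a (vel i)) x)
    - (\<Sum>a\<in>UNIV. pderiv_sp a lrho x * (pderiv_sp i (vel a) x - pderiv_sp a (vel i) x))"
    unfolding forall_3 curl_nth [of \<omega>] right_diff_distrib [of "exp _"] *
      pderiv_coord_curl [OF C2_pderiv_differentiable [OF Ck_vel x]] sum_levi_civita
    unfolding sum_3 curl_nth
      pderiv_commute [OF Ck_vel x, of "sp 2" "sp 1"] pderiv_commute [OF Ck_vel x, of "sp 3" "sp 1"]
      pderiv_commute [OF Ck_vel x, of "sp 3" "sp 2"]
    by algebra
  then show ?thesis ..
qed

text \<open>For any covector \<open>n\<close>, the components of \<open>n \<times> curl v\<close> are
  \<open>n\<^sub>a (\<partial>\<^sub>i v\<^sup>a - \<partial>\<^sub>a v\<^sup>i)\<close>. In this form the cross product can be compared with the lower order terms of the wave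
  equation for \<open>v\<^sup>i\<close>.\<close>

lemma exp_grad_dens_cross_vorticity:
  "exp (lrho x) * (\<Sum>a\<in>UNIV. \<Sum>b\<in>UNIV. levi_civita i a b * pderiv_sp a lrho x * \<omega> x $ b)
    = (\<Sum>a\<in>UNIV. pderiv_sp a lrho x * (pderiv_sp i (vel a) x - pderiv_sp a (vel i) x))"
proof -
  have "exp (lrho x) * (\<Sum>a\<in>UNIV. \<Sum>b\<in>UNIV. levi_civita i a b * pderiv_sp a lrho x * \<omega> x $ b)
      = (\<Sum>a\<in>UNIV. \<Sum>b\<in>UNIV. levi_civita i a b * (pderiv_sp a lrho x * curl v x $ b))"
    by (simp add: curl_vel sum_distrib_left mult.assoc mult.left_commute)
  moreover have "\<forall>i. (\<Sum>a\<in>UNIV. \<Sum>b\<in>UNIV. levi_civita i a b * (pderiv_sp a lrho x * curl v x $ b))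
      = (\<Sum>a\<in>UNIV. pderiv_sp a lrho x * (pderiv_sp i (vel a) x - pderiv_sp a (vel i) x))"
    unfolding forall_3 sum_levi_civita curl_nth unfolding sum_3 by algebra
  ultimately show ?thesis
    by simp
qed

text \<open>The second order terms form \<open>c\<^sup>2 (\<Delta>v - \<nabla> div v)\<close>, which is
  \<open>- c\<^sup>2 curl curl v\<close> and so a first derivative of the vorticity.
  Passing from \<open>curl v\<close> to \<open>\<omega>\<close> costs one copy of \<open>c\<^sup>2 e\<^sup>\<varrho> \<nabla>\<varrho> \<times> \<omega> = - e\<^sup>\<varrho> B v \<times> \<omega>\<close>. A second copy is
  the antisymmetric combination \<open>c\<^sup>2 \<partial>\<^sub>a \<varrho> (\<partial>\<^sub>a v\<^sup>i - \<partial>\<^sub>i v\<^sup>a)\<close> by which the lower order terms differ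
  from a multiple of the contraction of \<open>d\<varrho>\<close> and \<open>dv\<^sup>i\<close>, whence the coefficient 2.\<close>

theorem wave_vel:
  assumes x: "x \<in> U"
  shows "acoustic_wave c lrho v (vel i) x =
    - (c (lrho x))\<^sup>2 * exp (lrho x) * curl \<omega> x $ i
    + 2 * exp (lrho x) * (\<Sum>a\<in>UNIV. \<Sum>b\<in>UNIV. levi_civita i a b * B (vel a) x * \<omega> x $ b)
    + Q_vel c lrho v i x"
proof -
  have "(\<Sum>a\<in>UNIV. \<Sum>b\<in>UNIV. levi_civita i a b * B (vel a) x * \<omega> x $ b)
      = - ((c (lrho x))\<^sup>2 * (\<Sum>a\<in>UNIV. \<Sum>b\<in>UNIV. levi_civita i a b * pderiv_sp a lrho x * \<omega> x $ b))"
    by (simp add: material_vel [OF x] sum_distrib_left sum_negf algebra_simps)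
  then have cross: "exp (lrho x) * (\<Sum>a\<in>UNIV. \<Sum>b\<in>UNIV. levi_civita i a b * B (vel a) x * \<omega> x $ b)
      = - ((c (lrho x))\<^sup>2 *
           (\<Sum>a\<in>UNIV. pderiv_sp a lrho x * (pderiv_sp i (vel a) x - pderiv_sp a (vel i) x)))"
    by (simp add: mult.left_commute flip: exp_grad_dens_cross_vorticity)
  \<comment> \<open>Moving one factor of \<open>c\<close> makes \<open>c\<^sup>-\<^sup>1 c'\<close> a common factor of all terms that contain \<open>c'\<close>; after
    that the two sides agree as polynomials.\<close>
  have cq: "c (lrho x) * deriv c (lrho x) = (c (lrho x))\<^sup>2 * (inverse (c (lrho x)) * deriv c (lrho x))"
    using speed_pos [of "lrho x"] by (simp add: power2_eq_square)
  have "acoustic_wave c lrho v (vel i) x =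
      - (c (lrho x))\<^sup>2 * (exp (lrho x) * curl \<omega> x $ i)
      + 2 * (exp (lrho x) * (\<Sum>a\<in>UNIV. \<Sum>b\<in>UNIV. levi_civita i a b * B (vel a) x * \<omega> x $ b))
      + Q_vel c lrho v i x"
    unfolding wave_eq [OF x Ck_vel] material_material_vel [OF x] cross exp_curl_vorticity [OF x]
      Q_vel_def contract_acoustic_inv
    unfolding sum_3
    using cq by algebra
  then show ?thesis
    by (simp only: mult.assoc)
qed

text \<open>The curl of the vorticity equation. The commutator with \<open>B\<close> and the derivative of the
  factor \<open>\<omega>\<^sup>c\<close> in the stretching term \<open>\<omega>\<^sup>c \<partial>\<^sub>c v\<^sup>b\<close> give the two halves of \<^const>\<open>P_vort\<close>. The second derivatives of \<open>v\<close> enter only as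
  \<open>\<omega>\<^sup>c \<partial>\<^sub>c (curl v)\<^sup>i\<close>, which the relation \<open>curl v = e\<^sup>\<varrho> \<omega>\<close> reduces to first derivatives of \<open>\<omega>\<close>
  and \<open>\<varrho>\<close>; the derivative of \<open>\<varrho>\<close> along \<open>\<omega>\<close> is then minus the divergence of \<open>\<omega>\<close>.\<close>

theorem material_curl_vorticity:
  assumes x: "x \<in> U"
  shows "B (\<lambda>y. curl \<omega> y $ i) x =
    exp (lrho x) * (\<Sum>a\<in>UNIV. \<omega> x $ a * pderiv_sp a (\<lambda>y. \<omega> y $ i) x)
    - exp (lrho x) * \<omega> x $ i * divg \<omega> x + P_vort v \<omega> i x"
proof -
  have d: "(\<lambda>y. \<omega> y $ b) differentiable (at x)" "pderiv_sp a (vel b) differentiable (at x)" for a b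
    by (rule C2_differentiable [OF Ck_vort x] C2_pderiv_differentiable [OF Ck_vel x])+
  have grad: "B (pderiv_sp a (\<lambda>y. \<omega> y $ b)) x =
      (\<Sum>k\<in>UNIV. pderiv_sp a (\<lambda>y. \<omega> y $ k) x * pderiv_sp k (vel b) x)
      - (\<Sum>k\<in>UNIV. pderiv_sp a (vel k) x * pderiv_sp k (\<lambda>y. \<omega> y $ b) x)
      + (\<Sum>k\<in>UNIV. \<omega> x $ k * pderiv_sp k (pderiv_sp a (vel b)) x)" for a b
  proof -
    have "pderiv_sp a (B (\<lambda>y. \<omega> y $ b)) x
        = pderiv_sp a (\<lambda>y. \<Sum>k\<in>UNIV. \<omega> y $ k * pderiv_sp k (vel b) y) x"
      by (rule pderiv_coord_cong [OF open_U x material_vorticity])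
    also have "\<dots> = (\<Sum>k\<in>UNIV. pderiv_sp a (\<lambda>y. \<omega> y $ k) x * pderiv_sp k (vel b) x)
        + (\<Sum>k\<in>UNIV. \<omega> x $ k * pderiv_sp k (pderiv_sp a (vel b)) x)"
      using d by (simp add: pderiv_coord_sum pderiv_coord_mult sum.distrib
          pderiv_commute [OF Ck_vel x, of "sp a"])
    finally show ?thesis
      by (simp add: material_pderiv [OF x Ck_vort])
  qed
  have "B (\<lambda>y. curl \<omega> y $ i) x = P_vort v \<omega> i x
      + (\<Sum>a\<in>UNIV. \<Sum>b\<in>UNIV. levi_civita i a b * (\<Sum>k\<in>UNIV. \<omega> x $ k * pderiv_sp k (pderiv_sp a (vel b)) x))"
    by (simp add: vf_apply_curl [OF C2_pderiv_differentiable [OF Ck_vort x]] grad P_vort_def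
        distrib_left sum.distrib)
  also have "(\<Sum>a\<in>UNIV. \<Sum>b\<in>UNIV. levi_civita i a b * (\<Sum>k\<in>UNIV. \<omega> x $ k * pderiv_sp k (pderiv_sp a (vel b)) x))
      = (\<Sum>k\<in>UNIV. \<omega> x $ k * pderiv_sp k (\<lambda>y. curl v y $ i) x)"
    unfolding pderiv_coord_curl [OF d(2)] sum_3 by algebra
  also have "\<dots> = exp (lrho x) * (\<Sum>a\<in>UNIV. \<omega> x $ a * pderiv_sp a (\<lambda>y. \<omega> y $ i) x)
      - exp (lrho x) * \<omega> x $ i * divg \<omega> x"
    unfolding pderiv_curl_vel [OF x] div_vorticity [OF x] sum_3 by algebra
  finally show ?thesis
    by simp
qed

end

section \<open>The speed of sound and the geometric wave-transport system\<close>

lemma sound_speed_log_pos: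
  assumes "\<forall>r>0. sound_speed p r > 0" "rbar > 0"
  shows "sound_speed_log p rbar s > 0"
  using assms by (simp add: sound_speed_log_def)

lemma sound_speed_log_has_deriv:
  assumes "smooth_pos p" "\<forall>r>0. sound_speed p r > 0" "rbar > 0"
  shows "(sound_speed_log p rbar has_real_derivative deriv (sound_speed_log p rbar) s) (at s)"
proof -
  have r: "rbar * exp s > 0"
    using assms(3) by simp
  have "(deriv ^^ 1) p differentiable (at (rbar * exp s))"
    using assms(1) r unfolding smooth_pos_def by blast
  then have p': "(deriv p has_real_derivative deriv (deriv p) (rbar * exp s)) (at (rbar * exp s))"
    by (simp add: DERIV_deriv_iff_real_differentiable)
  have pos: "deriv p (rbar * exp s) > 0"
    using assms(2) r by (auto simp: sound_speed_def)
  have "((\<lambda>s. rbar * exp s) has_real_derivative rbar * exp s) (at s)"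
    by (auto intro!: derivative_eq_intros)
  then have "((\<lambda>s. deriv p (rbar * exp s)) has_real_derivative
      deriv (deriv p) (rbar * exp s) * (rbar * exp s)) (at s)"
    by (rule DERIV_chain2 [where f = "deriv p" and g = "\<lambda>s. rbar * exp s", OF p'])
  then have "((\<lambda>s. sqrt (deriv p (rbar * exp s))) has_real_derivative
      inverse (sqrt (deriv p (rbar * exp s))) / 2 * (deriv (deriv p) (rbar * exp s) * (rbar * exp s))) (at s)"
    by (rule DERIV_chain2 [where f = sqrt and g = "\<lambda>s. deriv p (rbar * exp s)", OF DERIV_real_sqrt [OF pos]])
  then show ?thesis
    unfolding sound_speed_log_def [abs_def] sound_speed_def using DERIV_imp_deriv by metis
qed

theorem theorem2p1:
  fixes p :: "real \<Rightarrow> real" and rbar :: real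
    and U :: "spacetime set"
    and \<rho> lrho :: "spacetime \<Rightarrow> real"
    and v \<omega> :: "spacetime \<Rightarrow> real ^ 3"
    and c :: "real \<Rightarrow> real"
  assumes smooth: "smooth_pos p"
    and speed_pos: "\<forall>r>0. sound_speed p r > 0"
    and rbar_pos: "rbar > 0"
    and c_eq: "c = sound_speed_log p rbar"
    and open_U: "open U"
    and dens_pos: "\<forall>x\<in>U. \<rho> x > 0"
    and log_dens: "\<forall>x\<in>U. lrho x = ln (\<rho> x / rbar)"
    and C3_dens: "Ck_on 3 U lrho"
    and C3_vel: "\<forall>i. Ck_on 3 U (\<lambda>x. v x $ i)"
    and euler: "euler c lrho v U"
    and vort_eq: "\<omega> = specific_vorticity lrho v"
  shows "\<forall>x\<in>U.
    (\<forall>i. acoustic_wave c lrho v (\<lambda>y. v y $ i) x =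
       - (c (lrho x))\<^sup>2 * exp (lrho x) * curl \<omega> x $ i
       + 2 * exp (lrho x) * (\<Sum>a\<in>UNIV. \<Sum>b\<in>UNIV. levi_civita i a b
             * vf_apply (material v) (\<lambda>y. v y $ a) x * \<omega> x $ b)
       + Q_vel c lrho v i x) \<and>
    acoustic_wave c lrho v lrho x = Q_dens c lrho v x \<and>
    (\<forall>i. vf_apply (material v) (\<lambda>y. \<omega> y $ i) x =
       (\<Sum>a\<in>UNIV. \<omega> x $ a * pderiv_sp a (\<lambda>y. v y $ i) x)) \<and>
    divg \<omega> x = - (\<Sum>a\<in>UNIV. \<omega> x $ a * pderiv_sp a lrho x) \<and>
    (\<forall>i. vf_apply (material v) (\<lambda>y. curl \<omega> y $ i) x =
       exp (lrho x) * (\<Sum>a\<in>UNIV. \<omega> x $ a * pderiv_sp a (\<lambda>y. \<omega> y $ i) x)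
       - exp (lrho x) * \<omega> x $ i * divg \<omega> x
       + P_vort v \<omega> i x)"
proof -
  interpret euler_flow c lrho v U
    by unfold_locales
      (use open_U C3_dens C3_vel euler sound_speed_log_pos [OF speed_pos rbar_pos]
          sound_speed_log_has_deriv [OF smooth speed_pos rbar_pos] in \<open>simp_all add: c_eq\<close>)
  show ?thesis
    unfolding vort_eq
    using wave_vel wave_dens material_vorticity div_vorticity material_curl_vorticity by blast
qed

end
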